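(* The reflection matrix has the representation $$\mathfrak{R}(\xi)=-\mathcal{B}^{-1}(\xi)\,\mathcal{B}(w_{PS}(\xi)),\qquad \xi\in\mathcal{R},$$ (at points where it is defined), and the determinants of the reflection matrix and the boundary matrix are related by $$\det\mathfrak{R}(\xi)=\frac{\Delta(w_{PS}(\xi))}{\Delta(\xi)}=(\Delta(\xi))^{-2}\Big(\Delta(w_P(\xi))\Delta(w_S(\xi))+q_P(\xi)q_S(\xi)\mathcal{S}(\xi)\mathcal{P}(\xi)\Big).$$
   Context: Setting. Fix $\omega>0$, $H>0$ and real functions $\lambda,\mu\in C^3((-\infty,0])$ with $\mu\ge\alpha_0>0$, $2\mu+3\lambda\ge\beta_0>0$ for some constants $\alpha_0,\beta_0$, and $\lambda(Z)=\lambda_0$, $\mu(Z)=\mu_0$ (constants) for $Z<-H$. Put $\sigma_0=\lambda_0+2\mu_0$. Riemann surface. $\mathcal{R}$ is the four-fold cover of $\mathbb{C}$ on which $q_P=\sqrt{\omega^2/\sigma_0-\xi^2}$ and $q_S=\sqrt{\omega^2/\mu_0-\xi^2}$ are single-valued; a point of $\mathcal{R}$ is a triple $(\xi,q_P,q_S)$ with $q_P^2=\omega^2/\sigma_0-\xi^2$, $q_S^2=\omega^2/\mu_0-\xi^2$, denoted simply by $\xi$. The maps $w_P,w_S,w_{PS}:\mathcal{R}\to\mathcal{R}$ keep the complex number $\xi$ and act by $w_P:(q_P,q_S)\mapsto(-q_P,q_S)$, $w_S:(q_P,q_S)\mapsto(q_P,-q_S)$, $w_{PS}:(q_P,q_S)\mapsto(-q_P,-q_S)$.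 Jost solutions. $\psi_P^\pm,\psi_S^\pm$ are the solutions on $Z<0$ of the Rayleigh system $$(P\psi')'+\xi\,(N\psi'-(N^{T}\psi)')+(\omega^2 I-\xi^2M)\psi=0,$$ $P=\begin{pmatrix}\mu&0\\0&\lambda+2\mu\end{pmatrix}$, $M=\begin{pmatrix}\lambda+2\mu&0\\0&\mu\end{pmatrix}$, $N=\begin{pmatrix}0&-\lambda\\ \mu&0\end{pmatrix}$, which for $Z\le -H$ equal $\psi_P^\pm=\begin{pmatrix}-\xi\\ \pm i q_P\end{pmatrix}e^{\pm iZq_P}$, $\psi_S^\pm=\begin{pmatrix}\pm i q_S\\ -\xi\end{pmatrix}e^{\pm iZq_S}$. Boundary tractions: $\hat a(\psi)=i\big(\lambda(0^-)\xi\psi_1(0^-)+(\lambda(0^-)+2\mu(0^-))\psi_2'(0^-)\big)$, $\hat b(\psi)=-\xi\mu(0^-)\psi_2(0^-)+\mu(0^-)\psi_1'(0^-)$. Boundary matrix $\mathcal{B}=\begin{pmatrix}\hat a(\psi_P^-)&\hat a(\psi_S^-)\\ \hat b(\psi_P^-)&\hat b(\psi_S^-)\end{pmatrix}$, Rayleigh determinant $\Delta=\det\mathcal{B}$, functions on $\mathcal{R}$. Entire functions of $\xi\in\mathbb{C}$ (removable singularities removed): $\gamma_1=\tfrac12(\hat a(\psi_P^+)+\hat a(\psi_P^-))$, $\gamma_3=\tfrac1{2q_P}(\hat a(\psi_P^+)-\hat a(\psi_P^-))$, $\gamma_5=\tfrac12(\hat a(\psi_S^+)+\hat a(\psi_S^-))$,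 $\gamma_7=\tfrac1{2q_S}(\hat a(\psi_S^+)-\hat a(\psi_S^-))$, and $\gamma_2,\gamma_4,\gamma_6,\gamma_8$ are given by the same formulas as $\gamma_1,\gamma_3,\gamma_5,\gamma_7$ respectively with $\hat a$ replaced by $\hat b$; $\mathcal{P}=2(\gamma_1\gamma_4-\gamma_3\gamma_2)$, $\mathcal{S}=2(\gamma_5\gamma_8-\gamma_7\gamma_6)$. Reflection matrix. At points of $\mathcal{R}$ with $\Delta\ne0$, $q_P\ne0$, $q_S\neq0$, the numbers $R_1,R_2,\widetilde R_1,\widetilde R_2$ are defined by requiring that $g_P^+=\psi_P^++R_2\psi_P^--q_PR_1\psi_S^-$ and $g_S^+=\psi_S^++q_S\widetilde R_1\psi_P^-+\widetilde R_2\psi_S^-$ be traction free ($\hat a(g_P^+)=\hat b(g_P^+)=0$, $\hat a(g_S^+)=\hat b(g_S^+)=0$), and $\mathfrak{R}=\begin{pmatrix}R_2&q_S\widetilde R_1\\ -q_PR_1&\widetilde R_2\end{pmatrix}$. *)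

theory Defs
  imports "HOL-Analysis.Analysis"
begin

section \<open>Medium and Rayleigh system\<close>

text \<open>On the closed half-line the derivatives at the end point are one-sided.\<close>

definition C3_on :: "real set \<Rightarrow> (real \<Rightarrow> real) \<Rightarrow> bool" where
  "C3_on S f \<longleftrightarrow> (\<exists>f1 f2 f3.
     (\<forall>z\<in>S. (f has_real_derivative f1 z) (at z within S)
          \<and> (f1 has_real_derivative f2 z) (at z within S)
          \<and> (f2 has_real_derivative f3 z) (at z within S))
     \<and> continuous_on S f3)"

definition matP :: "(real \<Rightarrow> real) \<Rightarrow> (real \<Rightarrow> real) \<Rightarrow> real \<Rightarrow> complex^2^2" where
  "matP lam mu Z = vector [vector [of_real (mu Z), 0],
                           vector [0, of_real (lam Z + 2 * mu Z)]]"

definition matM :: "(real \<Rightarrow> real) \<Rightarrow> (real \<Rightarrow> real) \<Rightarrow> real \<Rightarrow> complex^2^2" where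
  "matM lam mu Z = vector [vector [of_real (lam Z + 2 * mu Z), 0],
                           vector [0, of_real (mu Z)]]"

definition matN :: "(real \<Rightarrow> real) \<Rightarrow> (real \<Rightarrow> real) \<Rightarrow> real \<Rightarrow> complex^2^2" where
  "matN lam mu Z = vector [vector [0, - of_real (lam Z)],
                           vector [of_real (mu Z), 0]]"

text \<open>Classical solutions on the open half-line. Differentiability of \<open>N\<^sup>T \<psi>\<close> follows from
  that of \<open>\<psi>\<close> and of the coefficients. The scalar-times-matrix products are written with
  \<open>mat c\<close>, the diagonal matrix with entries \<open>c\<close>.\<close>

definition rayleigh_solution ::
  "real \<Rightarrow> (real \<Rightarrow> real) \<Rightarrow> (real \<Rightarrow> real) \<Rightarrow> complex \<Rightarrow> (real \<Rightarrow> complex^2) \<Rightarrow> bool" where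
  "rayleigh_solution om lam mu \<xi> \<psi> \<longleftrightarrow> (\<forall>Z<0.
     \<psi> differentiable (at Z) \<and>
     (\<lambda>z. matP lam mu z *v vector_derivative \<psi> (at z)) differentiable (at Z) \<and>
     vector_derivative (\<lambda>z. matP lam mu z *v vector_derivative \<psi> (at z)) (at Z)
     + \<xi> *s (matN lam mu Z *v vector_derivative \<psi> (at Z)
            - vector_derivative (\<lambda>z. transpose (matN lam mu z) *v \<psi> z) (at Z))
     + (mat (of_real (om\<^sup>2)) - mat (\<xi>\<^sup>2) ** matM lam mu Z) *v \<psi> Z = 0)"

section \<open>The Riemann surface\<close>

type_synonym point = "complex \<times> complex \<times> complex"

definition surface :: "real \<Rightarrow> real \<Rightarrow> real \<Rightarrow> point set" where
  "surface om sig0 mu0 = {(\<xi>, qP, qS).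
     qP\<^sup>2 = of_real (om\<^sup>2 / sig0) - \<xi>\<^sup>2 \<and> qS\<^sup>2 = of_real (om\<^sup>2 / mu0) - \<xi>\<^sup>2}"

definition xi :: "point \<Rightarrow> complex" where "xi x = fst x"
definition qP :: "point \<Rightarrow> complex" where "qP x = fst (snd x)"
definition qS :: "point \<Rightarrow> complex" where "qS x = snd (snd x)"

definition wP :: "point \<Rightarrow> point" where "wP x = (xi x, - qP x, qS x)"
definition wS :: "point \<Rightarrow> point" where "wS x = (xi x, qP x, - qS x)"
definition wPS :: "point \<Rightarrow> point" where "wPS x = (xi x, - qP x, - qS x)"

section \<open>Jost solutions\<close>

text \<open>The argument \<open>s\<close> is the sign: \<open>1\<close> for \<open>\<psi>\<^sup>+\<close> and \<open>-1\<close> for \<open>\<psi>\<^sup>-\<close>. The values of \<open>\<psi>\<close> on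
  \<open>Z \<ge> 0\<close> are irrelevant; on \<open>Z < 0\<close> these conditions determine \<open>\<psi>\<close>.\<close>

definition jost_P ::
  "real \<Rightarrow> real \<Rightarrow> (real \<Rightarrow> real) \<Rightarrow> (real \<Rightarrow> real) \<Rightarrow> complex \<Rightarrow> point \<Rightarrow> (real \<Rightarrow> complex^2) \<Rightarrow> bool" where
  "jost_P om H lam mu s x \<psi> \<longleftrightarrow> rayleigh_solution om lam mu (xi x) \<psi> \<and>
     (\<forall>Z\<le>-H. \<psi> Z = exp (s * \<i> * of_real Z * qP x) *s vector [- xi x, s * \<i> * qP x])"

definition jost_S ::
  "real \<Rightarrow> real \<Rightarrow> (real \<Rightarrow> real) \<Rightarrow> (real \<Rightarrow> real) \<Rightarrow> complex \<Rightarrow> point \<Rightarrow> (real \<Rightarrow> complex^2) \<Rightarrow> bool" where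
  "jost_S om H lam mu s x \<psi> \<longleftrightarrow> rayleigh_solution om lam mu (xi x) \<psi> \<and>
     (\<forall>Z\<le>-H. \<psi> Z = exp (s * \<i> * of_real Z * qS x) *s vector [s * \<i> * qS x, - xi x])"

section \<open>Boundary tractions, boundary matrix, Rayleigh determinant\<close>

definition left0 :: "(real \<Rightarrow> 'a::t2_space) \<Rightarrow> 'a" where
  "left0 f = Lim (at_left 0) f"

definition trac_a :: "(real \<Rightarrow> real) \<Rightarrow> (real \<Rightarrow> real) \<Rightarrow> complex \<Rightarrow> (real \<Rightarrow> complex^2) \<Rightarrow> complex" where
  "trac_a lam mu \<xi> \<psi> = \<i> * (of_real (left0 lam) * \<xi> * left0 (\<lambda>Z. \<psi> Z $ 1)
     + of_real (left0 lam + 2 * left0 mu) * left0 (\<lambda>Z. vector_derivative \<psi> (at Z) $ 2))"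

definition trac_b :: "(real \<Rightarrow> real) \<Rightarrow> (real \<Rightarrow> real) \<Rightarrow> complex \<Rightarrow> (real \<Rightarrow> complex^2) \<Rightarrow> complex" where
  "trac_b lam mu \<xi> \<psi> = - \<xi> * of_real (left0 mu) * left0 (\<lambda>Z. \<psi> Z $ 2)
     + of_real (left0 mu) * left0 (\<lambda>Z. vector_derivative \<psi> (at Z) $ 1)"

definition traction_free ::
  "(real \<Rightarrow> real) \<Rightarrow> (real \<Rightarrow> real) \<Rightarrow> complex \<Rightarrow> (real \<Rightarrow> complex^2) \<Rightarrow> bool" where
  "traction_free lam mu \<xi> \<psi> \<longleftrightarrow> trac_a lam mu \<xi> \<psi> = 0 \<and> trac_b lam mu \<xi> \<psi> = 0"

type_synonym wave = "point \<Rightarrow> real \<Rightarrow> complex^2"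

definition bmat ::
  "(real \<Rightarrow> real) \<Rightarrow> (real \<Rightarrow> real) \<Rightarrow> wave \<Rightarrow> wave \<Rightarrow> point \<Rightarrow> complex^2^2" where
  "bmat lam mu psiPm psiSm x =
     vector [vector [trac_a lam mu (xi x) (psiPm x), trac_a lam mu (xi x) (psiSm x)],
             vector [trac_b lam mu (xi x) (psiPm x), trac_b lam mu (xi x) (psiSm x)]]"

definition Delta :: "(real \<Rightarrow> real) \<Rightarrow> (real \<Rightarrow> real) \<Rightarrow> wave \<Rightarrow> wave \<Rightarrow> point \<Rightarrow> complex" where
  "Delta lam mu psiPm psiSm x = det (bmat lam mu psiPm psiSm x)"

section \<open>The entire functions\<close>

text \<open>The functions below depend on \<open>\<xi>\<close> alone: exchanging the sheets of \<open>q\<^sub>P\<close> (or \<open>q\<^sub>S\<close>) exchanges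
  \<open>\<psi>\<^sub>P\<^sup>+\<close> and \<open>\<psi>\<^sub>P\<^sup>-\<close> (or \<open>\<psi>\<^sub>S\<^sup>+\<close> and \<open>\<psi>\<^sub>S\<^sup>-\<close>), so the even and odd parts do not see the choice of
  the point above \<open>\<xi>\<close>. To have functions on the complex plane we evaluate at one fixed
  such point.\<close>

definition lift :: "real \<Rightarrow> real \<Rightarrow> real \<Rightarrow> complex \<Rightarrow> point" where
  "lift om sig0 mu0 \<xi> =
     (\<xi>, csqrt (of_real (om\<^sup>2 / sig0) - \<xi>\<^sup>2), csqrt (of_real (om\<^sup>2 / mu0) - \<xi>\<^sup>2))"

text \<open>Here \<open>tr\<close> is a traction, \<open>q\<close> is \<open>q\<^sub>P\<close> or \<open>q\<^sub>S\<close>, and \<open>l\<close> is the above choice of points. The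
  quotient in \<open>odd_part\<close> has removable singularities at the zeros of \<open>q\<close>, where it is
  replaced by its limit.\<close>

definition even_part ::
  "(complex \<Rightarrow> (real \<Rightarrow> complex^2) \<Rightarrow> complex) \<Rightarrow> (complex \<Rightarrow> point) \<Rightarrow> wave \<Rightarrow> wave \<Rightarrow> complex \<Rightarrow> complex" where
  "even_part tr l psip psim \<xi> = (1/2) * (tr \<xi> (psip (l \<xi>)) + tr \<xi> (psim (l \<xi>)))"

definition odd_quot ::
  "(complex \<Rightarrow> (real \<Rightarrow> complex^2) \<Rightarrow> complex) \<Rightarrow> (point \<Rightarrow> complex) \<Rightarrow> (complex \<Rightarrow> point) \<Rightarrow> wave \<Rightarrow> wave
     \<Rightarrow> complex \<Rightarrow> complex" where
  "odd_quot tr q l psip psim \<xi> =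
     1 / (2 * q (l \<xi>)) * (tr \<xi> (psip (l \<xi>)) - tr \<xi> (psim (l \<xi>)))"

definition odd_part ::
  "(complex \<Rightarrow> (real \<Rightarrow> complex^2) \<Rightarrow> complex) \<Rightarrow> (point \<Rightarrow> complex) \<Rightarrow> (complex \<Rightarrow> point) \<Rightarrow> wave \<Rightarrow> wave
     \<Rightarrow> complex \<Rightarrow> complex" where
  "odd_part tr q l psip psim \<xi> =
     (if q (l \<xi>) \<noteq> 0 then odd_quot tr q l psip psim \<xi>
      else Lim (at \<xi>) (odd_quot tr q l psip psim))"

definition calP ::
  "real \<Rightarrow> real \<Rightarrow> real \<Rightarrow> (real \<Rightarrow> real) \<Rightarrow> (real \<Rightarrow> real) \<Rightarrow> wave \<Rightarrow> wave \<Rightarrow> complex \<Rightarrow> complex" where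
  "calP om sig0 mu0 lam mu psiPp psiPm \<xi> =
     (let l = lift om sig0 mu0;
          \<gamma>1 = even_part (trac_a lam mu) l psiPp psiPm \<xi>;
          \<gamma>2 = even_part (trac_b lam mu) l psiPp psiPm \<xi>;
          \<gamma>3 = odd_part (trac_a lam mu) qP l psiPp psiPm \<xi>;
          \<gamma>4 = odd_part (trac_b lam mu) qP l psiPp psiPm \<xi>
      in 2 * (\<gamma>1 * \<gamma>4 - \<gamma>3 * \<gamma>2))"

definition calS ::
  "real \<Rightarrow> real \<Rightarrow> real \<Rightarrow> (real \<Rightarrow> real) \<Rightarrow> (real \<Rightarrow> real) \<Rightarrow> wave \<Rightarrow> wave \<Rightarrow> complex \<Rightarrow> complex" where
  "calS om sig0 mu0 lam mu psiSp psiSm \<xi> =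
     (let l = lift om sig0 mu0;
          \<gamma>5 = even_part (trac_a lam mu) l psiSp psiSm \<xi>;
          \<gamma>6 = even_part (trac_b lam mu) l psiSp psiSm \<xi>;
          \<gamma>7 = odd_part (trac_a lam mu) qS l psiSp psiSm \<xi>;
          \<gamma>8 = odd_part (trac_b lam mu) qS l psiSp psiSm \<xi>
      in 2 * (\<gamma>5 * \<gamma>8 - \<gamma>7 * \<gamma>6))"

section \<open>Reflection matrix\<close>

text \<open>Both pairs are uniquely determined where \<open>\<Delta>\<close>, \<open>q\<^sub>P\<close> and \<open>q\<^sub>S\<close> do not vanish; the
  second one is \<open>R\<^sub>1\<close> tilde, \<open>R\<^sub>2\<close> tilde.\<close>

definition reflP ::
  "(real \<Rightarrow> real) \<Rightarrow> (real \<Rightarrow> real) \<Rightarrow> wave \<Rightarrow> wave \<Rightarrow> wave \<Rightarrow> point \<Rightarrow> complex \<times> complex" where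
  "reflP lam mu psiPp psiPm psiSm x = (THE (R1, R2).
     traction_free lam mu (xi x)
       (\<lambda>Z. psiPp x Z + R2 *s psiPm x Z - (qP x * R1) *s psiSm x Z))"

definition reflS ::
  "(real \<Rightarrow> real) \<Rightarrow> (real \<Rightarrow> real) \<Rightarrow> wave \<Rightarrow> wave \<Rightarrow> wave \<Rightarrow> point \<Rightarrow> complex \<times> complex" where
  "reflS lam mu psiSp psiPm psiSm x = (THE (R1, R2).
     traction_free lam mu (xi x)
       (\<lambda>Z. psiSp x Z + (qS x * R1) *s psiPm x Z + R2 *s psiSm x Z))"

definition reflmat ::
  "(real \<Rightarrow> real) \<Rightarrow> (real \<Rightarrow> real) \<Rightarrow> wave \<Rightarrow> wave \<Rightarrow> wave \<Rightarrow> wave \<Rightarrow> point \<Rightarrow> complex^2^2" where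
  "reflmat lam mu psiPp psiPm psiSp psiSm x =
     (let (R1, R2) = reflP lam mu psiPp psiPm psiSm x;
          (R1t, R2t) = reflS lam mu psiSp psiPm psiSm x
      in vector [vector [R2, qS x * R1t],
                 vector [- qP x * R1, R2t]])"

end

theory Submission
  imports Defs
begin

text \<open>In terms of the displacement and the momentum the Rayleigh system is a first-order linear
  system whose coefficients are bounded up to the boundary. Gronwall's inequality then gives two
  facts. Solutions are determined by their values on \<open>Z \<le> - H\<close>, so changing the sign of \<open>q\<^sub>P\<close> or
  \<open>q\<^sub>S\<close> exchanges the corresponding Jost solutions; and solutions and their derivatives have limits
  at the boundary, so the tractions are linear. That \<open>g\<^sub>P\<^sup>+\<close> and \<open>g\<^sub>S\<^sup>+\<close> are traction free is thus the
  matrix equation \<open>\<B> \<RR> = - \<B> \<circ> w\<^sub>P\<^sub>S\<close>, and the second formula for the determinant is the Pluecker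
  relation between the four traction vectors in \<open>\<complex>\<^sup>2\<close>, because \<open>q\<^sub>P \<P>\<close> and \<open>q\<^sub>S \<S>\<close> are the
  determinants formed from \<open>\<psi>\<^sub>P\<^sup>-\<close>, \<open>\<psi>\<^sub>P\<^sup>+\<close> and from \<open>\<psi>\<^sub>S\<^sup>-\<close>, \<open>\<psi>\<^sub>S\<^sup>+\<close>.\<close>

section \<open>Linear differential inequalities\<close>

text \<open>By Cauchy-Schwarz the derivative of \<open>y \<bullet> y\<close> is at most
  \<open>2 * K * (y \<bullet> y)\<close>, so \<open>y \<bullet> y\<close> times the decaying
  exponential is nonincreasing. The squared norm, unlike the norm, is differentiable at zeros of
  \<open>y\<close> too.\<close>

lemma gronwall_norm:
  fixes y :: "real \<Rightarrow> 'a::real_inner"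
  assumes deriv: "\<And>t. t \<in> {a..b} \<Longrightarrow> (y has_vector_derivative y' t) (at t)"
    and bound: "\<And>t. t \<in> {a..b} \<Longrightarrow> norm (y' t) \<le> K * norm (y t)"
    and "a \<le> b"
  shows "(norm (y b))\<^sup>2 \<le> (norm (y a))\<^sup>2 * exp (2 * K * (b - a))"
proof -
  define g where "g t = (y t \<bullet> y t) * exp (- 2 * K * (t - a))" for t
  have "g b \<le> g a"
  proof (rule DERIV_nonpos_imp_nonincreasing[OF \<open>a \<le> b\<close>])
    fix t assume t: "a \<le> t" "t \<le> b"
    let ?d = "2 * (y t \<bullet> y' t) - 2 * K * (y t \<bullet> y t)"
    have "((\<lambda>t. y t \<bullet> y t) has_derivative (\<lambda>h. y t \<bullet> (h *\<^sub>R y' t) + (h *\<^sub>R y' t) \<bullet> y t)) (at t)"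
      using deriv[of t] t unfolding has_vector_derivative_def
      by (intro has_derivative_inner) auto
    then have "((\<lambda>t. y t \<bullet> y t) has_real_derivative 2 * (y t \<bullet> y' t)) (at t)"
      unfolding has_field_derivative_def
      by (rule has_derivative_eq_rhs) (auto simp: inner_commute)
    then have "(g has_real_derivative ?d * exp (- 2 * K * (t - a))) (at t)"
      unfolding g_def by (auto intro!: derivative_eq_intros simp: algebra_simps)
    moreover have "y t \<bullet> y' t \<le> K * (y t \<bullet> y t)"
    proof -
      have "y t \<bullet> y' t \<le> norm (y t) * norm (y' t)"
        by (rule norm_cauchy_schwarz)
      also have "\<dots> \<le> norm (y t) * (K * norm (y t))"
        using bound[of t] t by (intro mult_left_mono) auto
      finally show ?thesis
        by (simp add: dot_square_norm power2_eq_square mult_ac)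
    qed
    ultimately show "\<exists>d. (g has_real_derivative d) (at t) \<and> d \<le> 0"
      by (intro exI[of _ "?d * exp (- 2 * K * (t - a))"]) (auto simp: mult_nonpos_nonneg)
  qed
  then have "(norm (y b))\<^sup>2 * exp (- 2 * K * (b - a)) \<le> (norm (y a))\<^sup>2"
    by (simp add: g_def dot_square_norm)
  then have "(norm (y b))\<^sup>2 * exp (- 2 * K * (b - a)) * exp (2 * K * (b - a))
      \<le> (norm (y a))\<^sup>2 * exp (2 * K * (b - a))"
    by (rule mult_right_mono) simp
  then show ?thesis
    by (simp add: mult.assoc flip: exp_add)
qed

text \<open>Gronwall bounds \<open>y\<close> on the half-open interval, hence also
  \<open>y'\<close>. So \<open>y\<close> is Lipschitz there, and a uniformly continuous function
  extends to the closure. This yields boundary values although the equation is only given for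
  \<open>Z < 0\<close>.\<close>

lemma linear_growth_tendsto_at_left:
  fixes y :: "real \<Rightarrow> 'a::euclidean_space"
  assumes deriv: "\<And>t. t \<in> {a..<b} \<Longrightarrow> (y has_vector_derivative y' t) (at t)"
    and bound: "\<And>t. t \<in> {a..<b} \<Longrightarrow> norm (y' t) \<le> K * norm (y t)"
    and "0 \<le> K" and "a < b"
  shows "\<exists>l. (y \<longlongrightarrow> l) (at_left b)"
proof -
  define C where "C = K * sqrt ((norm (y a))\<^sup>2 * exp (2 * K * (b - a)))"
  have C: "norm (y' t) \<le> C" if t: "t \<in> {a..<b}" for t
  proof -
    have "(norm (y t))\<^sup>2 \<le> (norm (y a))\<^sup>2 * exp (2 * K * (t - a))"
      using t by (intro gronwall_norm[of a t y y'] deriv bound) auto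
    also have "\<dots> \<le> (norm (y a))\<^sup>2 * exp (2 * K * (b - a))"
      using t \<open>0 \<le> K\<close> by (intro mult_left_mono) (auto intro: mult_left_mono)
    finally have "norm (y t) \<le> sqrt ((norm (y a))\<^sup>2 * exp (2 * K * (b - a)))"
      by (rule real_le_rsqrt)
    then show ?thesis
      using bound[OF t] \<open>0 \<le> K\<close> unfolding C_def by (meson mult_left_mono order_trans)
  qed
  then have "C \<ge> 0"
    using \<open>a < b\<close> by (meson atLeastLessThan_iff norm_ge_zero order_refl order_trans)
  have "C-lipschitz_on {a..<b} y"
  proof (rule bounded_derivative_imp_lipschitz)
    show "(y has_derivative (\<lambda>h. h *\<^sub>R y' t)) (at t within {a..<b})" if "t \<in> {a..<b}" for t
      using deriv[OF that] by (simp add: has_vector_derivative_def has_derivative_at_withinI)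
    show "onorm (\<lambda>h. h *\<^sub>R y' t) \<le> C" if "t \<in> {a..<b}" for t
      using C[OF that] by (intro onorm_le) (auto simp: mult.commute[of C] intro: mult_left_mono)
  qed (use \<open>C \<ge> 0\<close> in auto)
  then have "uniformly_continuous_on {a..<b} y"
    by (rule lipschitz_on_uniformly_continuous)
  moreover have "b \<in> closure {a..<b}"
    using \<open>a < b\<close> by simp
  ultimately obtain l where "(y \<longlongrightarrow> l) (at b within {a..<b})"
    by (rule uniformly_continuous_on_extension_at_closure)
  moreover have "at b within {a..<b} = at_left b"
    using \<open>a < b\<close> by (intro at_within_nhd[of _ "{a<..}"]) auto
  ultimately show ?thesis
    by auto
qed

section \<open>The Rayleigh system as a first-order system\<close>

text \<open>The last two components are the momentum \<open>P \<psi>' - \<xi> N\<^sup>T \<psi>\<close>. In contrast to \<open>\<psi>'\<close>,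
  its derivative involves no derivative of the coefficients.\<close>

definition momentum_state ::
  "(real \<Rightarrow> real) \<Rightarrow> (real \<Rightarrow> real) \<Rightarrow> complex \<Rightarrow> (real \<Rightarrow> complex^2) \<Rightarrow> real
     \<Rightarrow> complex \<times> complex \<times> complex \<times> complex" where
  "momentum_state lam mu \<xi> \<psi> Z =
     (\<psi> Z $ 1, \<psi> Z $ 2,
      of_real (mu Z) * vector_derivative \<psi> (at Z) $ 1 - \<xi> * of_real (mu Z) * \<psi> Z $ 2,
      of_real (lam Z + 2 * mu Z) * vector_derivative \<psi> (at Z) $ 2 + \<xi> * of_real (lam Z) * \<psi> Z $ 1)"

text \<open>Recovers \<open>\<psi>'\<close> from a state \<open>y\<close> by solving the formula for
  the momentum; \<open>l\<close> and \<open>m\<close> stand for the values of \<open>lam\<close> and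
  \<open>mu\<close> at the given depth.\<close>

definition state_velocity ::
  "complex \<Rightarrow> complex \<times> complex \<times> complex \<times> complex \<Rightarrow> real \<Rightarrow> real \<Rightarrow> complex \<times> complex" where
  "state_velocity \<xi> y l m =
     (fst (snd (snd y)) / of_real m + \<xi> * fst (snd y),
      (snd (snd (snd y)) - \<xi> * of_real l * fst y) / of_real (l + 2 * m))"

text \<open>The right-hand side of the first-order system. Its last two components are the rows of
  \<open>- \<xi> N \<psi>' - (\<omega>\<^sup>2 I - \<xi>\<^sup>2 M) \<psi>\<close>, with
  \<open>\<psi>'\<close> expressed through the state.\<close>

definition state_field ::
  "real \<Rightarrow> complex \<Rightarrow> real \<Rightarrow> real \<Rightarrow> complex \<times> complex \<times> complex \<times> complex
     \<Rightarrow> complex \<times> complex \<times> complex \<times> complex" where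
  "state_field om \<xi> l m y =
     (let v = state_velocity \<xi> y l m in
      (fst v, snd v,
       \<xi> * of_real l * snd v - (of_real (om\<^sup>2) - \<xi>\<^sup>2 * of_real (l + 2 * m)) * fst y,
       - \<xi> * of_real m * fst v - (of_real (om\<^sup>2) - \<xi>\<^sup>2 * of_real m) * fst (snd y)))"

lemma state_velocity_diff:
  "state_velocity \<xi> (y - z) l m = state_velocity \<xi> y l m - state_velocity \<xi> z l m"
  unfolding state_velocity_def fst_diff snd_diff diff_Pair
  by (simp only: right_diff_distrib diff_divide_distrib prod.inject) simp

lemma state_velocity_scaleR:
  "state_velocity \<xi> (r *\<^sub>R y) l m = r *\<^sub>R state_velocity \<xi> y l m"
  unfolding state_velocity_def fst_scaleR snd_scaleR scaleR_Pair
  by (simp only: divide_inverse mult_scaleR_left mult_scaleR_right scaleR_add_right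
      scaleR_right_diff_distrib left_diff_distrib prod.inject)

lemma state_field_diff:
  "state_field om \<xi> l m (y - z) = state_field om \<xi> l m y - state_field om \<xi> l m z"
  unfolding state_field_def Let_def state_velocity_diff fst_diff snd_diff diff_Pair
  by (simp only: right_diff_distrib prod.inject) simp

lemma state_field_scaleR:
  "state_field om \<xi> l m (r *\<^sub>R y) = r *\<^sub>R state_field om \<xi> l m y"
  unfolding state_field_def Let_def state_velocity_scaleR fst_scaleR snd_scaleR scaleR_Pair
  by (simp only: mult_scaleR_right scaleR_right_diff_distrib prod.inject)

text \<open>The field is continuous on the compact product of the interval and the unit sphere,
  hence bounded there; homogeneity in \<open>y\<close> carries the bound to all states.\<close>

lemma state_field_bounded:
  fixes lam mu :: "real \<Rightarrow> real"
  assumes "continuous_on {a..b} lam" "continuous_on {a..b} mu"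
    and "\<And>Z. Z \<in> {a..b} \<Longrightarrow> mu Z \<noteq> 0" "\<And>Z. Z \<in> {a..b} \<Longrightarrow> lam Z + 2 * mu Z \<noteq> 0"
  shows "\<exists>K\<ge>0. \<forall>Z\<in>{a..b}. \<forall>y. norm (state_field om \<xi> (lam Z) (mu Z) y) \<le> K * norm y"
proof -
  let ?S = "{a..b} \<times> sphere (0 :: complex \<times> complex \<times> complex \<times> complex) 1"
  let ?F = "\<lambda>p. state_field om \<xi> (lam (fst p)) (mu (fst p)) (snd p)"
  have [continuous_intros]: "continuous_on ?S (\<lambda>p. lam (fst p))" "continuous_on ?S (\<lambda>p. mu (fst p))"
    by (auto intro!: continuous_on_compose2[OF assms(1)] continuous_on_compose2[OF assms(2)]
        continuous_intros)
  have nz: "complex_of_real (mu Z) \<noteq> 0" "complex_of_real (lam Z) + 2 * of_real (mu Z) \<noteq> 0"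
    if "Z \<in> {a..b}" for Z
  proof -
    show "complex_of_real (mu Z) \<noteq> 0" using assms(3)[OF that] by simp
    have "complex_of_real (lam Z + 2 * mu Z) \<noteq> 0"
      using assms(4)[OF that] by (simp only: of_real_eq_0_iff not_False_eq_True)
    then show "complex_of_real (lam Z) + 2 * of_real (mu Z) \<noteq> 0" by simp
  qed
  have "continuous_on ?S ?F"
    unfolding state_field_def state_velocity_def Let_def
    by (auto intro!: continuous_intros dest: nz)
  then have "compact (?F ` ?S)"
    by (intro compact_continuous_image compact_Times compact_Icc compact_sphere)
  then obtain K where "K > 0" and K: "\<forall>v\<in>?F ` ?S. norm v \<le> K"
    by (meson bounded_pos compact_imp_bounded)
  have "norm (state_field om \<xi> (lam Z) (mu Z) y) \<le> K * norm y" if "Z \<in> {a..b}" for Z y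
  proof (cases "y = 0")
    case True
    then show ?thesis using state_field_scaleR[of om \<xi> "lam Z" "mu Z" 0 y] by simp
  next
    case False
    then have "norm (state_field om \<xi> (lam Z) (mu Z) (sgn y)) \<le> K"
      using K that by (force simp: norm_sgn)
    then have "norm y * norm (state_field om \<xi> (lam Z) (mu Z) (sgn y)) \<le> norm y * K"
      by (intro mult_left_mono) auto
    also have "norm y * norm (state_field om \<xi> (lam Z) (mu Z) (sgn y))
        = norm (state_field om \<xi> (lam Z) (mu Z) (norm y *\<^sub>R sgn y))"
      unfolding state_field_scaleR by simp
    also have "norm y *\<^sub>R sgn y = y"
      using False by (simp add: sgn_div_norm)
    finally show ?thesis by (simp add: mult.commute)
  qed
  with \<open>K > 0\<close> show ?thesis by (intro exI[of _ K]) auto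
qed

text \<open>The momentum is \<open>?p - \<xi> ?n\<close>. The notion of solution makes
  \<open>?p\<close> differentiable, and regularity of the coefficients does so for
  \<open>?n\<close>; the Rayleigh equation, solved for the derivative of this combination, is the
  last half of the system.\<close>

lemma momentum_state_has_vector_derivative:
  assumes sol: "rayleigh_solution om lam mu \<xi> \<psi>"
    and "lam differentiable (at Z)" "mu differentiable (at Z)"
    and "mu Z \<noteq> 0" "lam Z + 2 * mu Z \<noteq> 0" and "Z < 0"
  shows "(momentum_state lam mu \<xi> \<psi> has_vector_derivative
          state_field om \<xi> (lam Z) (mu Z) (momentum_state lam mu \<xi> \<psi> Z)) (at Z)"
proof -
  let ?d = "\<lambda>z. vector_derivative \<psi> (at z)"
  let ?p = "\<lambda>z. matP lam mu z *v ?d z"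
  let ?n = "\<lambda>z. transpose (matN lam mu z) *v \<psi> z"
  define dp dn where "dp = vector_derivative ?p (at Z)" and "dn = vector_derivative ?n (at Z)"
  have eq: "dp + \<xi> *s (matN lam mu Z *v ?d Z - dn)
      + (mat (of_real (om\<^sup>2)) - mat (\<xi>\<^sup>2) ** matM lam mu Z) *v \<psi> Z = 0"
    and diff\<psi>: "\<psi> differentiable (at Z)" and diffp: "?p differentiable (at Z)"
    using sol \<open>Z < 0\<close> unfolding rayleigh_solution_def dp_def dn_def by auto
  have d\<psi>: "(\<psi> has_vector_derivative ?d Z) (at Z)"
    using diff\<psi> vector_derivative_works by blast
  \<comment> \<open>Constant matrices with \<open>N\<^sup>T = mu ?A + lam ?B\<close>, so that the
    product rule applies with scalar coefficients.\<close>
  let ?A = "vector [vector [0, 1], vector [0, 0]] :: complex^2^2"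
  let ?B = "vector [vector [0, 0], vector [- 1, 0]] :: complex^2^2"
  have "?n = (\<lambda>z. mu z *\<^sub>R (?A *v \<psi> z) + lam z *\<^sub>R (?B *v \<psi> z))"
    by (simp add: fun_eq_iff vec_eq_iff forall_2 matrix_vector_mult_def sum_2 transpose_def matN_def
        scaleR_conv_of_real[where 'a = complex])
  then have diffn: "?n differentiable (at Z)"
    using assms by (auto intro!: differentiable_add differentiable_scaleR differentiableI_vector[OF
          bounded_linear.has_vector_derivative[OF matrix_vector_mul_bounded_linear d\<psi>]])
  have dp: "(?p has_vector_derivative dp) (at Z)"
    unfolding dp_def using diffp vector_derivative_works by blast
  have dn: "(?n has_vector_derivative dn) (at Z)"
    unfolding dn_def using diffn vector_derivative_works by blast
  note nth = bounded_linear.has_vector_derivative[OF bounded_linear_vec_nth]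
  have mom: "((\<lambda>z. ?p z $ i - \<xi> * ?n z $ i) has_vector_derivative dp $ i - \<xi> * dn $ i) (at Z)" for i
    by (intro has_vector_derivative_diff nth[OF dp]
        bounded_linear.has_vector_derivative[OF bounded_linear_mult_right nth[OF dn]])
  have state_eq: "momentum_state lam mu \<xi> \<psi> =
      (\<lambda>z. (\<psi> z $ 1, \<psi> z $ 2, ?p z $ 1 - \<xi> * ?n z $ 1, ?p z $ 2 - \<xi> * ?n z $ 2))"
    by (simp add: fun_eq_iff momentum_state_def matrix_vector_mult_def sum_2 transpose_def
        matN_def matP_def algebra_simps)
  have "(momentum_state lam mu \<xi> \<psi> has_vector_derivative
      (?d Z $ 1, ?d Z $ 2, dp $ 1 - \<xi> * dn $ 1, dp $ 2 - \<xi> * dn $ 2)) (at Z)"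
    unfolding state_eq by (intro has_vector_derivative_Pair nth[OF d\<psi>] mom)
  moreover have "state_velocity \<xi> (momentum_state lam mu \<xi> \<psi> Z) (lam Z) (mu Z) = (?d Z $ 1, ?d Z $ 2)"
  proof -
    have "complex_of_real (lam Z + 2 * mu Z) \<noteq> 0"
      using assms(5) by (simp only: of_real_eq_0_iff not_False_eq_True)
    then show ?thesis
      using assms(4) by (simp add: state_velocity_def momentum_state_def field_simps del: of_real_add)
  qed
  moreover have "dp $ 1 - \<xi> * dn $ 1 = \<xi> * of_real (lam Z) * ?d Z $ 2
        - (of_real (om\<^sup>2) - \<xi>\<^sup>2 * of_real (lam Z + 2 * mu Z)) * \<psi> Z $ 1"
    using arg_cong[OF eq, of "\<lambda>v. v $ 1"]
    by (simp add: matrix_vector_mult_def matrix_matrix_mult_def sum_2 matN_def matM_def mat_def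
        algebra_simps add_eq_0_iff)
  moreover have "dp $ 2 - \<xi> * dn $ 2 = - \<xi> * of_real (mu Z) * ?d Z $ 1
        - (of_real (om\<^sup>2) - \<xi>\<^sup>2 * of_real (mu Z)) * \<psi> Z $ 2"
    using arg_cong[OF eq, of "\<lambda>v. v $ 2"]
    by (simp add: matrix_vector_mult_def matrix_matrix_mult_def sum_2 matN_def matM_def mat_def
        algebra_simps add_eq_0_iff)
  ultimately show ?thesis
    by (simp add: state_field_def momentum_state_def Let_def)
qed


section \<open>Media with positive moduli and uniqueness of solutions\<close>

locale elastic_medium =
  fixes lam mu :: "real \<Rightarrow> real"
  assumes lam_continuous: "continuous_on {..0} lam" and mu_continuous: "continuous_on {..0} mu"
    and lam_differentiable: "Z < 0 \<Longrightarrow> lam differentiable (at Z)"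
    and mu_differentiable: "Z < 0 \<Longrightarrow> mu differentiable (at Z)"
    and mu_pos: "Z \<le> 0 \<Longrightarrow> mu Z > 0"
    and P_wave_modulus_pos: "Z \<le> 0 \<Longrightarrow> lam Z + 2 * mu Z > 0"
begin

lemma field_bounded:
  obtains K where "K \<ge> 0"
    "\<And>Z y. Z \<in> {a..0} \<Longrightarrow> norm (state_field om \<xi> (lam Z) (mu Z) y) \<le> K * norm y"
proof -
  have "continuous_on {a..0} lam" "continuous_on {a..0} mu"
    using lam_continuous mu_continuous by (auto elim: continuous_on_subset)
  moreover have "mu Z \<noteq> 0" "lam Z + 2 * mu Z \<noteq> 0" if "Z \<in> {a..0}" for Z
    using mu_pos[of Z] P_wave_modulus_pos[of Z] that by auto
  ultimately show thesis
    using state_field_bounded[of a 0 lam mu om \<xi>] that by blast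
qed

lemma momentum_state_deriv:
  assumes "rayleigh_solution om lam mu \<xi> \<psi>" "Z < 0"
  shows "(momentum_state lam mu \<xi> \<psi> has_vector_derivative
          state_field om \<xi> (lam Z) (mu Z) (momentum_state lam mu \<xi> \<psi> Z)) (at Z)"
  using assms mu_pos[of Z] P_wave_modulus_pos[of Z] lam_differentiable mu_differentiable
  by (intro momentum_state_has_vector_derivative) auto

text \<open>The difference of the two states solves the same linear system and vanishes at one
  depth, so Gronwall keeps it zero from there up to any \<open>Z < 0\<close>.\<close>

lemma rayleigh_solution_unique:
  assumes \<psi>: "rayleigh_solution om lam mu \<xi> \<psi>" and \<phi>: "rayleigh_solution om lam mu \<xi> \<phi>"
    and "H > 0" and eq: "\<And>Z. Z \<le> - H \<Longrightarrow> \<psi> Z = \<phi> Z" and "Z < 0"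
  shows "\<psi> Z = \<phi> Z"
proof (cases "Z \<le> - H")
  case False
  \<comment> \<open>Strictly below \<open>- H\<close>, so that the solutions agree in a whole
    neighbourhood of \<open>a\<close> and their derivatives, hence their momenta, agree at
    \<open>a\<close>.\<close>
  define a where "a = - H - 1"
  define y where "y Z = momentum_state lam mu \<xi> \<psi> Z - momentum_state lam mu \<xi> \<phi> Z" for Z
  obtain K where K: "K \<ge> 0"
    "\<And>Z y. Z \<in> {a..0} \<Longrightarrow> norm (state_field om \<xi> (lam Z) (mu Z) y) \<le> K * norm y"
    using field_bounded by blast
  have "vector_derivative \<psi> (at a) = vector_derivative \<phi> (at a)"
    by (intro vector_derivative_cong_eq refl)
      (auto intro!: eventually_mono[OF eventually_nhds_in_open[of "{..<- H}"]] eq simp: a_def)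
  then have "y a = 0"
    using eq[of a] by (simp add: y_def momentum_state_def a_def)
  have "(norm (y Z))\<^sup>2 \<le> (norm (y a))\<^sup>2 * exp (2 * K * (Z - a))"
  proof (rule gronwall_norm)
    fix t assume t: "t \<in> {a..Z}"
    show "(y has_vector_derivative state_field om \<xi> (lam t) (mu t) (y t)) (at t)"
      unfolding y_def state_field_diff using t \<open>Z < 0\<close>
      by (intro has_vector_derivative_diff momentum_state_deriv \<psi> \<phi>) auto
    show "norm (state_field om \<xi> (lam t) (mu t) (y t)) \<le> K * norm (y t)"
      using t \<open>Z < 0\<close> by (intro K) auto
  qed (use False in \<open>simp add: a_def\<close>)
  with \<open>y a = 0\<close> have "y Z = 0"
    by simp
  then show ?thesis
    by (simp add: y_def momentum_state_def vec_eq_iff forall_2 zero_prod_def)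
qed (use eq in auto)

end

section \<open>Tractions as linear functionals\<close>

text \<open>Since \<open>left0\<close> is a \<open>Lim\<close>, it says something only where the
  limit exists; this predicate records existence of the limits along with their values.\<close>

definition has_traces :: "(real \<Rightarrow> complex^2) \<Rightarrow> complex^2 \<Rightarrow> complex^2 \<Rightarrow> bool" where
  "has_traces \<psi> u d \<longleftrightarrow> (\<forall>Z<0. \<psi> differentiable (at Z)) \<and> (\<psi> \<longlongrightarrow> u) (at_left 0) \<and>
     ((\<lambda>Z. vector_derivative \<psi> (at Z)) \<longlongrightarrow> d) (at_left 0)"

text \<open>The state converges at the boundary because its growth is linear. The limit of
  \<open>\<psi>'\<close> then follows, as the velocity depends continuously on the state and on the
  coefficients, whose moduli stay nonzero at 0.\<close>

lemma (in elastic_medium) rayleigh_solution_has_traces: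
  assumes sol: "rayleigh_solution om lam mu \<xi> \<psi>"
  shows "\<exists>u d. has_traces \<psi> u d"
proof -
  let ?y = "momentum_state lam mu \<xi> \<psi>" and ?d = "\<lambda>Z. vector_derivative \<psi> (at Z)"
  obtain K where K: "K \<ge> 0"
    "\<And>Z y. Z \<in> {- 1..0} \<Longrightarrow> norm (state_field om \<xi> (lam Z) (mu Z) y) \<le> K * norm y"
    using field_bounded by blast
  have "\<exists>l. (?y \<longlongrightarrow> l) (at_left 0)"
  proof (rule linear_growth_tendsto_at_left)
    show "(?y has_vector_derivative state_field om \<xi> (lam t) (mu t) (?y t)) (at t)"
      "norm (state_field om \<xi> (lam t) (mu t) (?y t)) \<le> K * norm (?y t)" if "t \<in> {- 1..<0}" for t
      using that by (auto intro!: momentum_state_deriv[OF sol] K)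
  qed (use \<open>K \<ge> 0\<close> in auto)
  then obtain l where l: "(?y \<longlongrightarrow> l) (at_left 0)"
    by blast
  have y: "((\<lambda>Z. fst (?y Z)) \<longlongrightarrow> fst l) (at_left 0)"
    "((\<lambda>Z. fst (snd (?y Z))) \<longlongrightarrow> fst (snd l)) (at_left 0)"
    by (intro tendsto_fst tendsto_snd l)+
  have "at_left (0::real) \<le> at 0 within {..0}"
    by (intro at_le) auto
  then have coeff: "(lam \<longlongrightarrow> lam 0) (at_left 0)" "(mu \<longlongrightarrow> mu 0) (at_left 0)"
    using lam_continuous mu_continuous unfolding continuous_on_def
    by (auto intro: tendsto_mono)
  have nz: "complex_of_real (mu Z) \<noteq> 0" "complex_of_real (lam Z + 2 * mu Z) \<noteq> 0" if "Z \<le> 0" for Z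
    using mu_pos[OF that] P_wave_modulus_pos[OF that]
    by (simp_all only: of_real_eq_0_iff)
  define v where "v = state_velocity \<xi> l (lam 0) (mu 0)"
  have v: "((\<lambda>Z. state_velocity \<xi> (?y Z) (lam Z) (mu Z)) \<longlongrightarrow> v) (at_left 0)"
    unfolding v_def state_velocity_def
    by (intro tendsto_intros l coeff nz) auto
  have y_eq: "?y Z = (\<psi> Z $ 1, \<psi> Z $ 2, snd (snd (?y Z)))"
    and v_eq: "Z < 0 \<Longrightarrow> state_velocity \<xi> (?y Z) (lam Z) (mu Z) = (?d Z $ 1, ?d Z $ 2)" for Z
    using nz[of Z]
    by (simp_all add: momentum_state_def state_velocity_def field_simps del: of_real_add)
  have "(\<psi> \<longlongrightarrow> vector [fst l, fst (snd l)]) (at_left 0)"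
  proof (rule vec_tendstoI)
    fix i :: 2
    show "((\<lambda>Z. \<psi> Z $ i) \<longlongrightarrow> vector [fst l, fst (snd l)] $ i) (at_left 0)"
      using y exhaust_2[of i] by (auto simp: momentum_state_def)
  qed
  moreover have "(?d \<longlongrightarrow> vector [fst v, snd v]) (at_left 0)"
  proof (rule vec_tendstoI)
    fix i :: 2
    have ev: "\<forall>\<^sub>F Z in at_left 0. Z < (0::real)"
      by (simp add: eventually_at_left_field) (metis lt_ex)
    have "((\<lambda>Z. ?d Z $ 1) \<longlongrightarrow> fst v) (at_left 0)"
      by (rule Lim_transform_eventually[OF tendsto_fst[OF v]])
        (use ev in eventually_elim, simp add: v_eq)
    moreover have "((\<lambda>Z. ?d Z $ 2) \<longlongrightarrow> snd v) (at_left 0)"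
      by (rule Lim_transform_eventually[OF tendsto_snd[OF v]])
        (use ev in eventually_elim, simp add: v_eq)
    ultimately show "((\<lambda>Z. ?d Z $ i) \<longlongrightarrow> vector [fst v, snd v] $ i) (at_left 0)"
      using exhaust_2[of i] by auto
  qed
  ultimately show ?thesis
    using sol unfolding has_traces_def rayleigh_solution_def by blast
qed

lemma left0_eq: "(f \<longlongrightarrow> l) (at_left 0) \<Longrightarrow> left0 f = l"
  by (simp add: left0_def tendsto_Lim)

lemma traction_eq_of_traces:
  assumes "has_traces \<psi> u d"
  shows "trac_a lam mu \<xi> \<psi> = \<i> * (of_real (left0 lam) * \<xi> * u $ 1
           + of_real (left0 lam + 2 * left0 mu) * d $ 2)"
    and "trac_b lam mu \<xi> \<psi> = - \<xi> * of_real (left0 mu) * u $ 2 + of_real (left0 mu) * d $ 1"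
proof -
  have "left0 (\<lambda>Z. \<psi> Z $ i) = u $ i" "left0 (\<lambda>Z. vector_derivative \<psi> (at Z) $ i) = d $ i" for i
    using assms by (auto simp: has_traces_def intro!: left0_eq tendsto_vec_nth)
  then show "trac_a lam mu \<xi> \<psi> = \<i> * (of_real (left0 lam) * \<xi> * u $ 1
           + of_real (left0 lam + 2 * left0 mu) * d $ 2)"
    and "trac_b lam mu \<xi> \<psi> = - \<xi> * of_real (left0 mu) * u $ 2 + of_real (left0 mu) * d $ 1"
    by (simp_all add: trac_a_def trac_b_def)
qed

text \<open>Multiplication by a complex scalar is the action of a scalar matrix, and this is bounded
  and linear over the reals.\<close>

lemma bounded_linear_vector_scalar_mult: "bounded_linear ((*s) c :: complex^2 \<Rightarrow> complex^2)"
proof -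
  have "(*s) c = (*v) (mat c :: complex^2^2)"
    by (simp add: fun_eq_iff vec_eq_iff forall_2 matrix_vector_mult_def sum_2 mat_def)
  then show ?thesis
    by simp
qed

text \<open>Three terms with leading coefficient 1 are the shape of the reflected waves
  \<open>g\<^sub>P\<^sup>+\<close> and \<open>g\<^sub>S\<^sup>+\<close>.\<close>

lemma has_traces_lincomb:
  assumes "has_traces \<psi>1 u1 d1" "has_traces \<psi>2 u2 d2" "has_traces \<psi>3 u3 d3"
  shows "has_traces (\<lambda>Z. \<psi>1 Z + b *s \<psi>2 Z + c *s \<psi>3 Z) (u1 + b *s u2 + c *s u3) (d1 + b *s d2 + c *s d3)"
proof -
  let ?\<psi> = "\<lambda>Z. \<psi>1 Z + b *s \<psi>2 Z + c *s \<psi>3 Z"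
  let ?d = "\<lambda>Z. vector_derivative \<psi>1 (at Z) + b *s vector_derivative \<psi>2 (at Z)
    + c *s vector_derivative \<psi>3 (at Z)"
  have deriv: "(?\<psi> has_vector_derivative ?d Z) (at Z)" if "Z < 0" for Z
    using assms that unfolding has_traces_def
    by (intro has_vector_derivative_add
        bounded_linear.has_vector_derivative[OF bounded_linear_vector_scalar_mult])
      (simp_all flip: vector_derivative_works)
  have "(?\<psi> \<longlongrightarrow> u1 + b *s u2 + c *s u3) (at_left 0)"
    and lim: "(?d \<longlongrightarrow> d1 + b *s d2 + c *s d3) (at_left 0)"
    using assms unfolding has_traces_def
    by (auto intro!: tendsto_add bounded_linear.tendsto[OF bounded_linear_vector_scalar_mult])
  moreover have "((\<lambda>Z. vector_derivative ?\<psi> (at Z)) \<longlongrightarrow> d1 + b *s d2 + c *s d3) (at_left 0)"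
  proof (rule Lim_transform_eventually[OF lim])
    have "\<forall>\<^sub>F Z in at_left 0. Z < (0::real)"
      by (simp add: eventually_at_left_field) (metis lt_ex)
    then show "\<forall>\<^sub>F Z in at_left 0. ?d Z = vector_derivative ?\<psi> (at Z)"
      by eventually_elim (simp add: vector_derivative_at[OF deriv])
  qed
  ultimately show ?thesis
    unfolding has_traces_def using deriv differentiableI_vector by blast
qed

lemma traction_lincomb:
  assumes "\<exists>u d. has_traces \<psi>1 u d" "\<exists>u d. has_traces \<psi>2 u d" "\<exists>u d. has_traces \<psi>3 u d"
  shows "trac_a lam mu \<xi> (\<lambda>Z. \<psi>1 Z + b *s \<psi>2 Z + c *s \<psi>3 Z)
           = trac_a lam mu \<xi> \<psi>1 + b * trac_a lam mu \<xi> \<psi>2 + c * trac_a lam mu \<xi> \<psi>3"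
    and "trac_b lam mu \<xi> (\<lambda>Z. \<psi>1 Z + b *s \<psi>2 Z + c *s \<psi>3 Z)
           = trac_b lam mu \<xi> \<psi>1 + b * trac_b lam mu \<xi> \<psi>2 + c * trac_b lam mu \<xi> \<psi>3"
proof -
  obtain u1 d1 u2 d2 u3 d3 where
    t: "has_traces \<psi>1 u1 d1" "has_traces \<psi>2 u2 d2" "has_traces \<psi>3 u3 d3"
    using assms by blast
  note simps = t[THEN traction_eq_of_traces(1)] t[THEN traction_eq_of_traces(2)]
    traction_eq_of_traces[OF has_traces_lincomb[OF t]]
  show "trac_a lam mu \<xi> (\<lambda>Z. \<psi>1 Z + b *s \<psi>2 Z + c *s \<psi>3 Z)
           = trac_a lam mu \<xi> \<psi>1 + b * trac_a lam mu \<xi> \<psi>2 + c * trac_a lam mu \<xi> \<psi>3"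
    and "trac_b lam mu \<xi> (\<lambda>Z. \<psi>1 Z + b *s \<psi>2 Z + c *s \<psi>3 Z)
           = trac_b lam mu \<xi> \<psi>1 + b * trac_b lam mu \<xi> \<psi>2 + c * trac_b lam mu \<xi> \<psi>3"
    unfolding simps by (simp_all add: algebra_simps)
qed

text \<open>Tractions are limits from the left of values and derivatives on the open half-line. This
  matters because Jost solutions are arbitrary for \<open>Z \<ge> 0\<close>.\<close>

lemma traction_cong:
  assumes "has_traces \<phi> u d" and eq: "\<And>Z. Z < 0 \<Longrightarrow> \<psi> Z = \<phi> Z"
  shows "trac_a lam mu \<xi> \<psi> = trac_a lam mu \<xi> \<phi>" and "trac_b lam mu \<xi> \<psi> = trac_b lam mu \<xi> \<phi>"
proof -
  have ev: "\<forall>\<^sub>F Z in at_left 0. Z < (0::real)"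
    by (simp add: eventually_at_left_field) (metis lt_ex)
  have deriv: "(\<psi> has_vector_derivative vector_derivative \<phi> (at Z)) (at Z)" if "Z < 0" for Z
    by (rule has_vector_derivative_transform_within_open[of \<phi> _ _ "{..<0}"])
      (use assms that in \<open>auto simp: has_traces_def simp flip: vector_derivative_works\<close>)
  have "has_traces \<psi> u d"
    unfolding has_traces_def
  proof (intro conjI allI impI)
    show "\<psi> differentiable (at Z)" if "Z < 0" for Z
      using deriv[OF that] by (rule differentiableI_vector)
    show "(\<psi> \<longlongrightarrow> u) (at_left 0)"
      by (rule Lim_transform_eventually[of \<phi>])
        (use assms ev in \<open>auto simp: has_traces_def elim!: eventually_mono\<close>)
    show "((\<lambda>Z. vector_derivative \<psi> (at Z)) \<longlongrightarrow> d) (at_left 0)"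
      by (rule Lim_transform_eventually[of "\<lambda>Z. vector_derivative \<phi> (at Z)"])
        (use assms ev in \<open>auto simp: has_traces_def vector_derivative_at[OF deriv] elim!: eventually_mono\<close>)
  qed
  with assms show "trac_a lam mu \<xi> \<psi> = trac_a lam mu \<xi> \<phi>" "trac_b lam mu \<xi> \<psi> = trac_b lam mu \<xi> \<phi>"
    by (simp_all add: traction_eq_of_traces)
qed

section \<open>Tractions of Jost solutions on different sheets\<close>

context elastic_medium
begin

text \<open>The prescribed wave on \<open>Z \<le> - H\<close> involves the sign and
  \<open>qP\<close> only through their product, and uniqueness propagates the equality to the
  boundary. Opposite signs on opposite sheets therefore give equal tractions, and changing the sign
  of \<open>qS\<close> has no effect.\<close>

lemma jost_P_traction_eq:
  assumes \<psi>: "jost_P om H lam mu s x \<psi>" and \<phi>: "jost_P om H lam mu t y \<phi>"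
    and "xi x = xi y" and st: "s * qP x = t * qP y" and "H > 0"
  shows "trac_a lam mu \<xi> \<psi> = trac_a lam mu \<xi> \<phi>" and "trac_b lam mu \<xi> \<psi> = trac_b lam mu \<xi> \<phi>"
proof -
  have "\<psi> Z = \<phi> Z" if "Z \<le> - H" for Z
  proof -
    have q: "s * \<i> * of_real Z * qP x = t * \<i> * of_real Z * qP y" "s * \<i> * qP x = t * \<i> * qP y"
      using st by algebra+
    have "\<psi> Z = exp (s * \<i> * of_real Z * qP x) *s vector [- xi x, s * \<i> * qP x]"
      using \<psi> that unfolding jost_P_def by blast
    also have "\<dots> = exp (t * \<i> * of_real Z * qP y) *s vector [- xi y, t * \<i> * qP y]"
      by (simp only: q \<open>xi x = xi y\<close>)
    also have "\<dots> = \<phi> Z"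
      using \<phi> that unfolding jost_P_def by simp
    finally show ?thesis .
  qed
  then have eq: "\<psi> Z = \<phi> Z" if "Z < 0" for Z
    using rayleigh_solution_unique[of om "xi y" \<psi> \<phi> H Z] \<psi> \<phi> \<open>xi x = xi y\<close> \<open>H > 0\<close> that
    unfolding jost_P_def by auto
  obtain u d where traces: "has_traces \<phi> u d"
    using \<phi> rayleigh_solution_has_traces unfolding jost_P_def by blast
  show "trac_a lam mu \<xi> \<psi> = trac_a lam mu \<xi> \<phi>"
    using traces eq by (rule traction_cong(1))
  show "trac_b lam mu \<xi> \<psi> = trac_b lam mu \<xi> \<phi>"
    using traces eq by (rule traction_cong(2))
qed

text \<open>The analogue for shear waves, where the sign enters only through its product with
  \<open>qS\<close>.\<close>

lemma jost_S_traction_eq: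
  assumes \<psi>: "jost_S om H lam mu s x \<psi>" and \<phi>: "jost_S om H lam mu t y \<phi>"
    and "xi x = xi y" and st: "s * qS x = t * qS y" and "H > 0"
  shows "trac_a lam mu \<xi> \<psi> = trac_a lam mu \<xi> \<phi>" and "trac_b lam mu \<xi> \<psi> = trac_b lam mu \<xi> \<phi>"
proof -
  have "\<psi> Z = \<phi> Z" if "Z \<le> - H" for Z
  proof -
    have q: "s * \<i> * of_real Z * qS x = t * \<i> * of_real Z * qS y" "s * \<i> * qS x = t * \<i> * qS y"
      using st by algebra+
    have "\<psi> Z = exp (s * \<i> * of_real Z * qS x) *s vector [s * \<i> * qS x, - xi x]"
      using \<psi> that unfolding jost_S_def by blast
    also have "\<dots> = exp (t * \<i> * of_real Z * qS y) *s vector [t * \<i> * qS y, - xi y]"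
      by (simp only: q \<open>xi x = xi y\<close>)
    also have "\<dots> = \<phi> Z"
      using \<phi> that unfolding jost_S_def by simp
    finally show ?thesis .
  qed
  then have eq: "\<psi> Z = \<phi> Z" if "Z < 0" for Z
    using rayleigh_solution_unique[of om "xi y" \<psi> \<phi> H Z] \<psi> \<phi> \<open>xi x = xi y\<close> \<open>H > 0\<close> that
    unfolding jost_S_def by auto
  obtain u d where traces: "has_traces \<phi> u d"
    using \<phi> rayleigh_solution_has_traces unfolding jost_S_def by blast
  show "trac_a lam mu \<xi> \<psi> = trac_a lam mu \<xi> \<phi>"
    using traces eq by (rule traction_cong(1))
  show "trac_b lam mu \<xi> \<psi> = trac_b lam mu \<xi> \<phi>"
    using traces eq by (rule traction_cong(2))
qed

end

section \<open>Reflection coefficients and determinants\<close>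

text \<open>Cramer's rule, stated for a pair \<open>p\<close> to match the descriptions over pairs
  in \<open>reflP\<close> and \<open>reflS\<close>.\<close>

lemma linear_system_2_ex1:
  fixes a b c d e f :: "'a::field"
  assumes "a * d - b * c \<noteq> 0"
  shows "\<exists>!p. a * fst p + b * snd p = e \<and> c * fst p + d * snd p = f"
proof
  let ?D = "a * d - b * c"
  have "a * (d * e - b * f) + b * (a * f - c * e) = e * ?D"
    "c * (d * e - b * f) + d * (a * f - c * e) = f * ?D"
    by algebra+
  then show "a * fst ((d * e - b * f) / ?D, (a * f - c * e) / ?D)
      + b * snd ((d * e - b * f) / ?D, (a * f - c * e) / ?D) = e
    \<and> c * fst ((d * e - b * f) / ?D, (a * f - c * e) / ?D)
      + d * snd ((d * e - b * f) / ?D, (a * f - c * e) / ?D) = f"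
    using assms by (simp flip: add_divide_distrib)
next
  fix p assume p: "a * fst p + b * snd p = e \<and> c * fst p + d * snd p = f"
  have "fst p * (a * d - b * c) = d * e - b * f"
    using p by (auto simp: algebra_simps)
  moreover have "snd p * (a * d - b * c) = a * f - c * e"
    using p by (auto simp: algebra_simps)
  ultimately show "p = ((d * e - b * f) / (a * d - b * c), (a * f - c * e) / (a * d - b * c))"
    using assms by (simp add: prod_eq_iff field_simps)
qed

text \<open>By linearity of the tractions, being traction free is a linear system for
  \<open>R1\<close> and \<open>R2\<close> with determinant \<open>qP x\<close> times
  \<open>Delta\<close>. It is nonzero, so the description in \<open>reflP\<close> denotes the
  solution.\<close>

lemma reflP_eq:
  assumes "\<exists>u d. has_traces (psiPp x) u d" "\<exists>u d. has_traces (psiPm x) u d"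
    "\<exists>u d. has_traces (psiSm x) u d"
    and "Delta lam mu psiPm psiSm x \<noteq> 0" and "qP x \<noteq> 0"
  obtains R1 R2 where "reflP lam mu psiPp psiPm psiSm x = (R1, R2)"
    "R2 * trac_a lam mu (xi x) (psiPm x) - qP x * R1 * trac_a lam mu (xi x) (psiSm x)
       = - trac_a lam mu (xi x) (psiPp x)"
    "R2 * trac_b lam mu (xi x) (psiPm x) - qP x * R1 * trac_b lam mu (xi x) (psiSm x)
       = - trac_b lam mu (xi x) (psiPp x)"
proof -
  let ?a = "trac_a lam mu (xi x)" and ?b = "trac_b lam mu (xi x)"
  have fun_eq: "(\<lambda>Z. psiPp x Z + R2 *s psiPm x Z - (qP x * R1) *s psiSm x Z)
      = (\<lambda>Z. psiPp x Z + R2 *s psiPm x Z + (- (qP x * R1)) *s psiSm x Z)" for R1 R2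
    by (simp add: fun_eq_iff vec_eq_iff)
  have iff: "traction_free lam mu (xi x)
        (\<lambda>Z. psiPp x Z + R2 *s psiPm x Z - (qP x * R1) *s psiSm x Z) \<longleftrightarrow>
      (- (qP x * ?a (psiSm x))) * R1 + ?a (psiPm x) * R2 = - ?a (psiPp x) \<and>
      (- (qP x * ?b (psiSm x))) * R1 + ?b (psiPm x) * R2 = - ?b (psiPp x)" for R1 R2
    unfolding traction_free_def fun_eq traction_lincomb[OF assms(1-3)]
    by (simp add: eq_neg_iff_add_eq_0 algebra_simps)
  have "(- (qP x * ?a (psiSm x))) * ?b (psiPm x) - ?a (psiPm x) * (- (qP x * ?b (psiSm x)))
      = qP x * Delta lam mu psiPm psiSm x"
    by (simp add: Delta_def bmat_def det_2 algebra_simps)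
  then have "\<exists>!p. (- (qP x * ?a (psiSm x))) * fst p + ?a (psiPm x) * snd p = - ?a (psiPp x) \<and>
      (- (qP x * ?b (psiSm x))) * fst p + ?b (psiPm x) * snd p = - ?b (psiPp x)"
    using assms(4,5) by (intro linear_system_2_ex1) simp
  from theI'[OF this] have
    "(- (qP x * ?a (psiSm x))) * fst (reflP lam mu psiPp psiPm psiSm x)
       + ?a (psiPm x) * snd (reflP lam mu psiPp psiPm psiSm x) = - ?a (psiPp x)"
    "(- (qP x * ?b (psiSm x))) * fst (reflP lam mu psiPp psiPm psiSm x)
       + ?b (psiPm x) * snd (reflP lam mu psiPp psiPm psiSm x) = - ?b (psiPp x)"
    unfolding reflP_def iff case_prod_beta by blast+
  then show thesis
    by (intro that[OF prod.collapse[symmetric]]) algebra+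
qed

text \<open>The same argument, now with determinant \<open>qS x\<close> times
  \<open>Delta\<close>.\<close>

lemma reflS_eq:
  assumes "\<exists>u d. has_traces (psiSp x) u d" "\<exists>u d. has_traces (psiPm x) u d"
    "\<exists>u d. has_traces (psiSm x) u d"
    and "Delta lam mu psiPm psiSm x \<noteq> 0" and "qS x \<noteq> 0"
  obtains R1 R2 where "reflS lam mu psiSp psiPm psiSm x = (R1, R2)"
    "qS x * R1 * trac_a lam mu (xi x) (psiPm x) + R2 * trac_a lam mu (xi x) (psiSm x)
       = - trac_a lam mu (xi x) (psiSp x)"
    "qS x * R1 * trac_b lam mu (xi x) (psiPm x) + R2 * trac_b lam mu (xi x) (psiSm x)
       = - trac_b lam mu (xi x) (psiSp x)"
proof -
  let ?a = "trac_a lam mu (xi x)" and ?b = "trac_b lam mu (xi x)"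
  have iff: "traction_free lam mu (xi x)
        (\<lambda>Z. psiSp x Z + (qS x * R1) *s psiPm x Z + R2 *s psiSm x Z) \<longleftrightarrow>
      (qS x * ?a (psiPm x)) * R1 + ?a (psiSm x) * R2 = - ?a (psiSp x) \<and>
      (qS x * ?b (psiPm x)) * R1 + ?b (psiSm x) * R2 = - ?b (psiSp x)" for R1 R2
    unfolding traction_free_def traction_lincomb[OF assms(1-3)]
    by (simp add: eq_neg_iff_add_eq_0 algebra_simps)
  have "(qS x * ?a (psiPm x)) * ?b (psiSm x) - ?a (psiSm x) * (qS x * ?b (psiPm x))
      = qS x * Delta lam mu psiPm psiSm x"
    by (simp add: Delta_def bmat_def det_2 algebra_simps)
  then have "\<exists>!p. (qS x * ?a (psiPm x)) * fst p + ?a (psiSm x) * snd p = - ?a (psiSp x) \<and>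
      (qS x * ?b (psiPm x)) * fst p + ?b (psiSm x) * snd p = - ?b (psiSp x)"
    using assms(4,5) by (intro linear_system_2_ex1) simp
  from theI'[OF this] have
    "(qS x * ?a (psiPm x)) * fst (reflS lam mu psiSp psiPm psiSm x)
       + ?a (psiSm x) * snd (reflS lam mu psiSp psiPm psiSm x) = - ?a (psiSp x)"
    "(qS x * ?b (psiPm x)) * fst (reflS lam mu psiSp psiPm psiSm x)
       + ?b (psiSm x) * snd (reflS lam mu psiSp psiPm psiSm x) = - ?b (psiSp x)"
    unfolding reflS_def iff case_prod_beta by blast+
  then show thesis
    by (intro that[OF prod.collapse[symmetric]]) algebra+
qed

section \<open>The functions \<open>calP\<close> and \<open>calS\<close> as determinants of
  tractions\<close>

lemma lift_mem_surface: "lift om sig0 mu0 \<xi> \<in> surface om sig0 mu0"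
  by (simp add: lift_def surface_def)

text \<open>Passing from the plus and minus tractions to their half sum and half difference only
  rescales a determinant by a constant; \<open>q\<close> cancels the denominator of the odd
  part.\<close>

lemma even_odd_determinant:
  assumes "q (l \<xi>) \<noteq> 0"
  shows "q (l \<xi>) * (2 * (even_part f l psip psim \<xi> * odd_part g q l psip psim \<xi>
           - odd_part f q l psip psim \<xi> * even_part g l psip psim \<xi>))
         = f \<xi> (psim (l \<xi>)) * g \<xi> (psip (l \<xi>)) - f \<xi> (psip (l \<xi>)) * g \<xi> (psim (l \<xi>))"
  using assms by (simp add: even_part_def odd_part_def odd_quot_def field_simps)

text \<open>\<open>calP\<close> is computed at the chosen point \<open>y\<close> above
  \<open>xi x\<close>, which may lie on another sheet than \<open>x\<close>; the identity at
  \<open>y\<close> has to be carried over to \<open>x\<close>.\<close>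

lemma (in elastic_medium) calP_eq:
  assumes jost: "\<forall>y\<in>surface om sig0 mu0.
      jost_P om H lam mu 1 y (psiPp y) \<and> jost_P om H lam mu (-1) y (psiPm y)"
    and x: "x \<in> surface om sig0 mu0" and "qP x \<noteq> 0" and "H > 0"
  shows "qP x * calP om sig0 mu0 lam mu psiPp psiPm (xi x)
    = trac_a lam mu (xi x) (psiPm x) * trac_b lam mu (xi x) (psiPp x)
      - trac_a lam mu (xi x) (psiPp x) * trac_b lam mu (xi x) (psiPm x)"
proof -
  define y where "y = lift om sig0 mu0 (xi x)"
  have y: "y \<in> surface om sig0 mu0" and xi: "xi y = xi x"
    unfolding y_def by (rule lift_mem_surface) (simp add: lift_def xi_def)
  have "(qP y)\<^sup>2 = (qP x)\<^sup>2"
    using x y xi by (auto simp: surface_def qP_def xi_def)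
  then have q: "qP y = qP x \<or> qP y = - qP x"
    by (simp add: power2_eq_iff)
  then have "qP y \<noteq> 0"
    using \<open>qP x \<noteq> 0\<close> by auto
  then have det: "qP y * calP om sig0 mu0 lam mu psiPp psiPm (xi x)
    = trac_a lam mu (xi x) (psiPm y) * trac_b lam mu (xi x) (psiPp y)
      - trac_a lam mu (xi x) (psiPp y) * trac_b lam mu (xi x) (psiPm y)"
    unfolding y_def calP_def Let_def by (rule even_odd_determinant)
  have jx: "jost_P om H lam mu 1 x (psiPp x)" "jost_P om H lam mu (-1) x (psiPm x)"
    and jy: "jost_P om H lam mu 1 y (psiPp y)" "jost_P om H lam mu (-1) y (psiPm y)"
    using jost x y by auto
  note eqs = jost_P_traction_eq[OF _ _ xi _ \<open>H > 0\<close>]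
  from q show ?thesis
  proof
    assume "qP y = qP x"
    with det eqs[OF jy(1) jx(1)] eqs[OF jy(2) jx(2)] show ?thesis by simp
  next
    \<comment> \<open>Here \<open>psiPp\<close> and \<open>psiPm\<close> exchange their tractions,
      so the determinant changes sign together with the factor \<open>qP\<close>.\<close>
    assume "qP y = - qP x"
    with det eqs[OF jy(1) jx(2)] eqs[OF jy(2) jx(1)] show ?thesis by (simp add: algebra_simps)
  qed
qed

lemma (in elastic_medium) calS_eq:
  assumes jost: "\<forall>y\<in>surface om sig0 mu0.
      jost_S om H lam mu 1 y (psiSp y) \<and> jost_S om H lam mu (-1) y (psiSm y)"
    and x: "x \<in> surface om sig0 mu0" and "qS x \<noteq> 0" and "H > 0"
  shows "qS x * calS om sig0 mu0 lam mu psiSp psiSm (xi x)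
    = trac_a lam mu (xi x) (psiSm x) * trac_b lam mu (xi x) (psiSp x)
      - trac_a lam mu (xi x) (psiSp x) * trac_b lam mu (xi x) (psiSm x)"
proof -
  define y where "y = lift om sig0 mu0 (xi x)"
  have y: "y \<in> surface om sig0 mu0" and xi: "xi y = xi x"
    unfolding y_def by (rule lift_mem_surface) (simp add: lift_def xi_def)
  have "(qS y)\<^sup>2 = (qS x)\<^sup>2"
    using x y xi by (auto simp: surface_def qS_def xi_def)
  then have q: "qS y = qS x \<or> qS y = - qS x"
    by (simp add: power2_eq_iff)
  then have "qS y \<noteq> 0"
    using \<open>qS x \<noteq> 0\<close> by auto
  then have det: "qS y * calS om sig0 mu0 lam mu psiSp psiSm (xi x)
    = trac_a lam mu (xi x) (psiSm y) * trac_b lam mu (xi x) (psiSp y)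
      - trac_a lam mu (xi x) (psiSp y) * trac_b lam mu (xi x) (psiSm y)"
    unfolding y_def calS_def Let_def by (rule even_odd_determinant)
  have jx: "jost_S om H lam mu 1 x (psiSp x)" "jost_S om H lam mu (-1) x (psiSm x)"
    and jy: "jost_S om H lam mu 1 y (psiSp y)" "jost_S om H lam mu (-1) y (psiSm y)"
    using jost x y by auto
  note eqs = jost_S_traction_eq[OF _ _ xi _ \<open>H > 0\<close>]
  from q show ?thesis
  proof
    assume "qS y = qS x"
    with det eqs[OF jy(1) jx(1)] eqs[OF jy(2) jx(2)] show ?thesis by simp
  next
    assume "qS y = - qS x"
    with det eqs[OF jy(1) jx(2)] eqs[OF jy(2) jx(1)] show ?thesis by (simp add: algebra_simps)
  qed
qed

section \<open>Matrix inversion, regularity of the coefficients, and the representation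
  formula\<close>

lemma eq_matrix_inv_mult:
  fixes B X C :: "'a::field^'n^'n"
  assumes "det B \<noteq> 0" and "B ** X = - C"
  shows "X = - matrix_inv B ** C"
proof -
  have "\<exists>B'. B ** B' = mat 1 \<and> B' ** B = mat 1"
    using assms(1) invertible_det_nz[of B] by (simp add: invertible_def)
  then have inv: "matrix_inv B ** B = mat 1"
    unfolding matrix_inv_def by (rule someI2_ex) simp
  have "X = matrix_inv B ** (- C)"
    by (metis assms(2) inv matrix_mul_assoc matrix_mul_lid)
  also have "\<dots> = - matrix_inv B ** C"
    by (simp add: matrix_matrix_mult_def vec_eq_iff)
  finally show ?thesis .
qed

lemma C3_on_differentiable:
  assumes "C3_on {..0} f" "Z < 0"
  shows "f differentiable (at Z)"
proof -
  obtain f1 where "(f has_real_derivative f1 Z) (at Z within {..0})"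
    using assms unfolding C3_on_def by fastforce
  moreover have "at Z within {..0} = at Z"
    using assms(2) by (intro at_within_interior) simp
  ultimately show ?thesis
    by (auto simp: real_differentiable_def)
qed

lemma C3_on_imp_continuous_on: "C3_on S f \<Longrightarrow> continuous_on S f"
  unfolding C3_on_def by (meson DERIV_continuous_on)

theorem lemma5p2:
  fixes om H alpha0 beta0 lam0 mu0 sig0 :: real
    and lam mu :: "real \<Rightarrow> real"
    and psiPp psiPm psiSp psiSm :: "point \<Rightarrow> real \<Rightarrow> complex^2"
    and x :: point
  assumes "om > 0" and "H > 0"
    and "C3_on {..0} lam" and "C3_on {..0} mu"
    and "alpha0 > 0" and "\<forall>Z\<le>0. mu Z \<ge> alpha0"
    and "beta0 > 0" and "\<forall>Z\<le>0. 2 * mu Z + 3 * lam Z \<ge> beta0"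
    and "\<forall>Z < - H. lam Z = lam0 \<and> mu Z = mu0"
    and "sig0 = lam0 + 2 * mu0"
    and "\<forall>y\<in>surface om sig0 mu0.
           jost_P om H lam mu 1 y (psiPp y) \<and> jost_P om H lam mu (-1) y (psiPm y) \<and>
           jost_S om H lam mu 1 y (psiSp y) \<and> jost_S om H lam mu (-1) y (psiSm y)"
    and "x \<in> surface om sig0 mu0"
    and "Delta lam mu psiPm psiSm x \<noteq> 0" and "qP x \<noteq> 0" and "qS x \<noteq> 0"
  shows "reflmat lam mu psiPp psiPm psiSp psiSm x
           = - matrix_inv (bmat lam mu psiPm psiSm x) ** bmat lam mu psiPm psiSm (wPS x)
       \<and> det (reflmat lam mu psiPp psiPm psiSp psiSm x)
           = Delta lam mu psiPm psiSm (wPS x) / Delta lam mu psiPm psiSm x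
       \<and> det (reflmat lam mu psiPp psiPm psiSp psiSm x)
           = Delta lam mu psiPm psiSm x powi (-2) *
             (Delta lam mu psiPm psiSm (wP x) * Delta lam mu psiPm psiSm (wS x)
              + qP x * qS x * calS om sig0 mu0 lam mu psiSp psiSm (xi x)
                            * calP om sig0 mu0 lam mu psiPp psiPm (xi x))"
proof -
  interpret elastic_medium lam mu
  proof
    show "continuous_on {..0} lam" "continuous_on {..0} mu"
      using assms(3,4) by (auto intro: C3_on_imp_continuous_on)
    show "lam differentiable (at Z)" "mu differentiable (at Z)" if "Z < 0" for Z
      using assms(3,4) that by (auto intro: C3_on_differentiable)
    \<comment> \<open>The second bound holds since \<open>3 * (lam Z + 2 * mu Z)\<close> is the sum
      of \<open>2 * mu Z + 3 * lam Z\<close> and \<open>4 * mu Z\<close>.\<close>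
    show "mu Z > 0" "lam Z + 2 * mu Z > 0" if "Z \<le> 0" for Z
      using assms(5-8) that by (smt (verit))+
  qed
  let ?a = "trac_a lam mu (xi x)" and ?b = "trac_b lam mu (xi x)"
  let ?B = "bmat lam mu psiPm psiSm" and ?D = "Delta lam mu psiPm psiSm"
  let ?R = "reflmat lam mu psiPp psiPm psiSp psiSm x"
  have jP: "\<forall>y\<in>surface om sig0 mu0.
      jost_P om H lam mu 1 y (psiPp y) \<and> jost_P om H lam mu (-1) y (psiPm y)"
    and jS: "\<forall>y\<in>surface om sig0 mu0.
      jost_S om H lam mu 1 y (psiSp y) \<and> jost_S om H lam mu (-1) y (psiSm y)"
    using assms(11) by auto
  have tr: "\<exists>u d. has_traces (psi x) u d" if "psi \<in> {psiPp, psiPm, psiSp, psiSm}" for psi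
    using that jP jS assms(12) unfolding jost_P_def jost_S_def
    by (auto intro: rayleigh_solution_has_traces)
  have mem: "wP x \<in> surface om sig0 mu0" "wS x \<in> surface om sig0 mu0" "wPS x \<in> surface om sig0 mu0"
    using assms(12) by (auto simp: surface_def wP_def wS_def wPS_def xi_def qP_def qS_def)
  have coords: "xi (wP x) = xi x" "xi (wS x) = xi x" "xi (wPS x) = xi x"
    "qP (wP x) = - qP x" "qP (wS x) = qP x" "qP (wPS x) = - qP x"
    "qS (wP x) = qS x" "qS (wS x) = - qS x" "qS (wPS x) = - qS x"
    by (simp_all add: wP_def wS_def wPS_def xi_def qP_def qS_def)
  \<comment> \<open>\<open>wP\<close> and \<open>wPS\<close> reverse \<open>qP\<close> and turn the
    minus wave into the plus wave, while \<open>wS\<close> leaves \<open>qP\<close> alone.\<close>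
  have P: "?a (psiPm (wP x)) = ?a (psiPp x)" "?b (psiPm (wP x)) = ?b (psiPp x)"
    "?a (psiPm (wPS x)) = ?a (psiPp x)" "?b (psiPm (wPS x)) = ?b (psiPp x)"
    "?a (psiPm (wS x)) = ?a (psiPm x)" "?b (psiPm (wS x)) = ?b (psiPm x)"
    using jP assms(2,12) mem coords
      jost_P_traction_eq[of om H "-1" "wP x" "psiPm (wP x)" 1 x "psiPp x"]
      jost_P_traction_eq[of om H "-1" "wPS x" "psiPm (wPS x)" 1 x "psiPp x"]
      jost_P_traction_eq[of om H "-1" "wS x" "psiPm (wS x)" "-1" x "psiPm x"]
    by auto
  have S: "?a (psiSm (wS x)) = ?a (psiSp x)" "?b (psiSm (wS x)) = ?b (psiSp x)"
    "?a (psiSm (wPS x)) = ?a (psiSp x)" "?b (psiSm (wPS x)) = ?b (psiSp x)"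
    "?a (psiSm (wP x)) = ?a (psiSm x)" "?b (psiSm (wP x)) = ?b (psiSm x)"
    using jS assms(2,12) mem coords
      jost_S_traction_eq[of om H "-1" "wS x" "psiSm (wS x)" 1 x "psiSp x"]
      jost_S_traction_eq[of om H "-1" "wPS x" "psiSm (wPS x)" 1 x "psiSp x"]
      jost_S_traction_eq[of om H "-1" "wP x" "psiSm (wP x)" "-1" x "psiSm x"]
    by auto
  have Ds: "?D x = ?a (psiPm x) * ?b (psiSm x) - ?a (psiSm x) * ?b (psiPm x)"
    "?D (wP x) = ?a (psiPp x) * ?b (psiSm x) - ?a (psiSm x) * ?b (psiPp x)"
    "?D (wS x) = ?a (psiPm x) * ?b (psiSp x) - ?a (psiSp x) * ?b (psiPm x)"
    "?D (wPS x) = ?a (psiPp x) * ?b (psiSp x) - ?a (psiSp x) * ?b (psiPp x)"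
    by (simp_all add: Delta_def bmat_def det_2 coords P S)
  obtain R1 R2 where R: "reflP lam mu psiPp psiPm psiSm x = (R1, R2)"
    "R2 * ?a (psiPm x) - qP x * R1 * ?a (psiSm x) = - ?a (psiPp x)"
    "R2 * ?b (psiPm x) - qP x * R1 * ?b (psiSm x) = - ?b (psiPp x)"
    by (rule reflP_eq[where psiPp = psiPp and x = x, OF _ _ _ assms(13,14)]) (auto intro: tr)
  obtain R1t R2t where Rt: "reflS lam mu psiSp psiPm psiSm x = (R1t, R2t)"
    "qS x * R1t * ?a (psiPm x) + R2t * ?a (psiSm x) = - ?a (psiSp x)"
    "qS x * R1t * ?b (psiPm x) + R2t * ?b (psiSm x) = - ?b (psiSp x)"
    by (rule reflS_eq[where psiSp = psiSp and x = x, OF _ _ _ assms(13,15)]) (auto intro: tr)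
  \<comment> \<open>The two columns are the conditions for \<open>g\<^sub>P\<^sup>+\<close> and
    \<open>g\<^sub>S\<^sup>+\<close>; at \<open>wPS x\<close> the boundary matrix consists of the
    tractions of the plus waves.\<close>
  have BR: "?B x ** ?R = - ?B (wPS x)"
    using R(2,3) Rt(2,3)
    by (simp add: reflmat_def R(1) Rt(1) bmat_def coords P S vec_eq_iff forall_2
        matrix_matrix_mult_def sum_2 mult.commute)
  \<comment> \<open>The minus sign disappears because the matrices have even size 2.\<close>
  have "?D x * det ?R = ?D (wPS x)"
    using arg_cong[OF BR, of det] unfolding det_mul by (simp add: Delta_def det_2)
  then have det: "det ?R = ?D (wPS x) / ?D x"
    using assms(13) by (simp add: field_simps)
  \<comment> \<open>Each root is grouped with the function of its own wave type, so that both
    factors become determinants of tractions.\<close>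
  have "qP x * qS x * calS om sig0 mu0 lam mu psiSp psiSm (xi x)
        * calP om sig0 mu0 lam mu psiPp psiPm (xi x)
      = (qS x * calS om sig0 mu0 lam mu psiSp psiSm (xi x))
        * (qP x * calP om sig0 mu0 lam mu psiPp psiPm (xi x))"
    by (simp add: mult_ac)
  \<comment> \<open>With \<open>[u,v]\<close> the determinant of two traction vectors and
    \<open>p\<close>, \<open>s\<close> those of the P and S waves, this is
    \<open>[p-,s-][p+,s+] = [p+,s-][p-,s+] + [s-,s+][p-,p+]\<close>.\<close>
  then have "?D x * ?D (wPS x) = ?D (wP x) * ?D (wS x)
      + qP x * qS x * calS om sig0 mu0 lam mu psiSp psiSm (xi x)
        * calP om sig0 mu0 lam mu psiPp psiPm (xi x)"
    unfolding calP_eq[OF jP assms(12,14,2)] calS_eq[OF jS assms(12,15,2)] Ds by algebra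
  moreover have "?D (wPS x) / ?D x = ?D x powi (-2) * (?D x * ?D (wPS x))"
    using assms(13) by (simp add: power_int_minus power2_eq_square field_simps)
  ultimately have "det ?R = ?D x powi (-2) * (?D (wP x) * ?D (wS x)
      + qP x * qS x * calS om sig0 mu0 lam mu psiSp psiSm (xi x)
        * calP om sig0 mu0 lam mu psiPp psiPm (xi x))"
    by (simp only: det)
  with det show ?thesis
    using eq_matrix_inv_mult[OF _ BR] assms(13) by (simp add: Delta_def)
qed

end
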